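(* Let $S:\mathbb R\to\mathbb R$ be a continuous, $1$-periodic function with $\int_0^1S(\sigma)\,d\sigma=0$, not identically zero. Let $\bar y,\bar y_v:\mathbb R\to\mathbb R$ be of class $C^2$ with bounded first and second derivatives. For $\varepsilon\in(0,1]$ and $n\in\mathbb N$, $n\ge1$, let $$y(t):=\bar y(t)+\varepsilon\,\bar y_v(t)\,S\!\left(\tfrac t\varepsilon\right),\qquad t\in\mathbb R,$$ and define the estimators $$\widehat{\bar y}(t):=\frac1{n\varepsilon}\int_{t-n\varepsilon}^{t}y(\tau)\,d\tau,$$ $$\widehat{\bar y_v}(t):=\frac1\varepsilon\;\frac{\displaystyle\frac1{n\varepsilon}\int_{t-n\varepsilon}^{t}\Big(y\big(\tau-\tfrac{n\varepsilon}2\big)-\widehat{\bar y}(\tau)\Big)\,S\!\left(\frac{\tau-\frac{n\varepsilon}{2}}{\varepsilon}\right)d\tau}{\displaystyle\frac1{n\varepsilon}\int_{t-n\varepsilon}^{t}S^2\!\left(\tfrac\tau\varepsilon\right)d\tau}.$$ Then $$\widehat{\bar y}(t)=\bar y\!\left(t-\tfrac{n\varepsilon}2\right)+\mathcal O_\infty(n^2\varepsilon^2)=\bar y(t)+\mathcal O_\infty(n\varepsilon),$$ $$\widehat{\bar y_v}(t)=\bar y_v(t)+\mathcal O_\infty(n^2\varepsilon).$$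
   Context: $\mathcal O_\infty$ is the uniform big-O symbol: $k=\mathcal O_\infty(\delta)$ means $|k|\le C\delta$ with a constant $C$ that may depend on $\bar y,\bar y_v,S$ but not on $t\in\mathbb R$, $n\ge1$ or $\varepsilon\in(0,1]$. *)

theory Defs
  imports "HOL-Analysis.Analysis"
begin

definition C2 :: "(real \<Rightarrow> real) \<Rightarrow> bool" where
  "C2 f \<longleftrightarrow> f differentiable_on UNIV \<and> deriv f differentiable_on UNIV
     \<and> continuous_on UNIV (deriv (deriv f))"

definition C2_bounded_derivs :: "(real \<Rightarrow> real) \<Rightarrow> bool" where
  "C2_bounded_derivs f \<longleftrightarrow>
     C2 f \<and> bounded (range (deriv f)) \<and> bounded (range (deriv (deriv f)))"

text \<open>
  The symbol \<open>k = O\<^sub>\<infinity>(\<delta>)\<close>, for a family \<open>k t n \<epsilon>\<close> and a bound \<open>\<delta> n \<epsilon>\<close>: one constant serves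
  all \<open>t\<close>, all \<open>n \<ge> 1\<close> and all \<open>\<epsilon> \<in> (0,1]\<close>; no limit is involved.
\<close>

definition O_infty :: "(real \<Rightarrow> nat \<Rightarrow> real \<Rightarrow> real) \<Rightarrow> (nat \<Rightarrow> real \<Rightarrow> real) \<Rightarrow> bool" where
  "O_infty k \<delta> \<longleftrightarrow>
     (\<exists>C. \<forall>t. \<forall>n\<ge>1. \<forall>\<epsilon>\<in>{0<..1}. \<bar>k t n \<epsilon>\<bar> \<le> C * \<delta> n \<epsilon>)"

definition signal :: "(real \<Rightarrow> real) \<Rightarrow> (real \<Rightarrow> real) \<Rightarrow> (real \<Rightarrow> real) \<Rightarrow> real \<Rightarrow> real \<Rightarrow> real" where
  "signal yb yv S \<epsilon> t = yb t + \<epsilon> * yv t * S (t / \<epsilon>)"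

text \<open>
  The estimators of \<open>yb\<close> and \<open>yv\<close> depend only on the measured signal \<open>y\<close>, the parameters \<open>n\<close> and
  \<open>\<epsilon>\<close> and, for the second one, on \<open>S\<close>.
\<close>

definition est_yb :: "(real \<Rightarrow> real) \<Rightarrow> nat \<Rightarrow> real \<Rightarrow> real \<Rightarrow> real" where
  "est_yb y n \<epsilon> t = 1 / (real n * \<epsilon>) * integral {t - real n * \<epsilon>..t} y"

definition est_yv :: "(real \<Rightarrow> real) \<Rightarrow> (real \<Rightarrow> real) \<Rightarrow> nat \<Rightarrow> real \<Rightarrow> real \<Rightarrow> real" where
  "est_yv S y n \<epsilon> t =
     1 / \<epsilon> *
     ((1 / (real n * \<epsilon>) * integral {t - real n * \<epsilon>..t}
         (\<lambda>\<tau>. (y (\<tau> - real n * \<epsilon> / 2) - est_yb y n \<epsilon> \<tau>) * S ((\<tau> - real n * \<epsilon> / 2) / \<epsilon>)))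
      / (1 / (real n * \<epsilon>) * integral {t - real n * \<epsilon>..t} (\<lambda>\<tau>. (S (\<tau> / \<epsilon>))\<^sup>2)))"

end

theory Submission
  imports Defs
begin

text \<open>
  Over a window of \<open>n\<close> periods the average of \<open>S (\<tau> / \<epsilon>)\<close> vanishes and that of \<open>(S (\<tau> / \<epsilon>))\<^sup>2\<close> is
  the constant \<open>\<integral>\<^sub>0\<^sup>1 S\<^sup>2 > 0\<close>. Hence \<open>yv\<close> may be frozen at the end point \<open>t\<close> of the window at the
  cost of a Lipschitz error proportional to \<open>n * \<epsilon>\<close>, which the factor \<open>\<epsilon>\<close> in the signal makes
  small enough. For \<open>yb\<close> one compares with the tangent at the midpoint, whose average is the
  midpoint value; only this comparison uses second derivatives.
\<close>

section \<open>Moving averages\<close>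

text \<open>Both estimators are built from this one operator. The end point \<open>t\<close> is an
  argument because the numerator of \<open>est_yv\<close> contains the inner average at a running
  end point.\<close>

definition avg :: "real \<Rightarrow> real \<Rightarrow> (real \<Rightarrow> real) \<Rightarrow> real" where
  "avg L t f = 1 / L * integral {t - L..t} f"

lemma est_yb_eq_avg: "est_yb y n \<epsilon> t = avg (real n * \<epsilon>) t y"
  by (simp add: est_yb_def avg_def)

lemma est_yv_eq_avg:
  "est_yv S y n \<epsilon> t =
     1 / \<epsilon> * (avg (real n * \<epsilon>) t
       (\<lambda>\<tau>. (y (\<tau> - real n * \<epsilon> / 2) - avg (real n * \<epsilon>) \<tau> y) * S ((\<tau> - real n * \<epsilon> / 2) / \<epsilon>))
     / avg (real n * \<epsilon>) t (\<lambda>\<tau>. (S (\<tau> / \<epsilon>))\<^sup>2))"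
  by (simp add: est_yv_def avg_def est_yb_eq_avg)

lemma avg_add:
  assumes "continuous_on UNIV f" "continuous_on UNIV g"
  shows "avg L t (\<lambda>\<tau>. f \<tau> + g \<tau>) = avg L t f + avg L t g"
proof -
  have "f integrable_on {t - L..t}" "g integrable_on {t - L..t}"
    using assms by (auto intro: integrable_continuous_real continuous_on_subset)
  then show ?thesis
    by (simp add: avg_def integral_add algebra_simps add_divide_distrib)
qed

lemma avg_cmult: "avg L t (\<lambda>\<tau>. c * f \<tau>) = c * avg L t f"
  by (simp add: avg_def)

text \<open>The tool behind every error estimate below: the integrand is compared pointwise with a
  function whose average is known exactly.\<close>

lemma avg_diff_le:
  assumes "L > 0" and "continuous_on UNIV f" "continuous_on UNIV g"
    and le: "\<And>\<tau>. \<tau> \<in> {t - L..t} \<Longrightarrow> \<bar>f \<tau> - g \<tau>\<bar> \<le> B"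
  shows "\<bar>avg L t f - avg L t g\<bar> \<le> B"
proof -
  have cont: "continuous_on {t - L..t} f" "continuous_on {t - L..t} g"
    using assms by (auto intro: continuous_on_subset)
  have "norm (integral {t - L..t} (\<lambda>\<tau>. f \<tau> - g \<tau>)) \<le> B * (t - (t - L))"
    using \<open>L > 0\<close> le by (intro integral_bound continuous_intros cont) auto
  moreover have "integral {t - L..t} (\<lambda>\<tau>. f \<tau> - g \<tau>)
      = integral {t - L..t} f - integral {t - L..t} g"
    using cont by (simp add: integral_diff integrable_continuous_real)
  moreover have "avg L t f - avg L t g = (integral {t - L..t} f - integral {t - L..t} g) / L"
    by (simp add: avg_def diff_divide_distrib)
  ultimately show ?thesis
    using \<open>L > 0\<close> by (simp add: abs_divide pos_divide_le_eq)
qed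

text \<open>The window is symmetric about \<open>t - L / 2\<close>, so the linear part cancels.
  Slope \<open>b = 0\<close> gives the average of a constant.\<close>

lemma avg_affine:
  assumes "L > 0"
  shows "avg L t (\<lambda>\<tau>. a + b * (\<tau> - (t - L / 2))) = a"
proof -
  let ?F = "\<lambda>\<tau>. a * \<tau> + b * (\<tau> - (t - L / 2))\<^sup>2 / 2"
  have "((\<lambda>\<tau>. a + b * (\<tau> - (t - L / 2))) has_integral (?F t - ?F (t - L))) {t - L..t}"
    using assms
    by (intro fundamental_theorem_of_calculus)
      (auto intro!: derivative_eq_intros simp flip: has_real_derivative_iff_has_vector_derivative)
  \<comment> \<open>Both ends lie at distance \<open>L / 2\<close> from the midpoint, so the
    quadratic terms of \<open>?F\<close> agree there.\<close>
  moreover have "?F t - ?F (t - L) = L * a"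
    by (simp add: field_simps power2_eq_square)
  ultimately show ?thesis
    using assms by (simp add: avg_def integral_unique)
qed

text \<open>A single primitive on the whole line expresses the integrals over all windows at once,
  wherever they lie.\<close>

lemma antiderivative_UNIV:
  fixes f :: "real \<Rightarrow> real"
  assumes "continuous_on UNIV f"
  obtains F where "\<And>x. (F has_real_derivative f x) (at x)"
proof -
  have "\<exists>F. \<forall>x::real. - \<infinity> < ereal x \<longrightarrow> ereal x < \<infinity> \<longrightarrow> (F has_vector_derivative f x) (at x)"
    using assms by (intro einterval_antiderivative) (auto simp: continuous_on_eq_continuous_at)
  then show thesis
    using that by (auto simp: has_real_derivative_iff_has_vector_derivative)
qed

lemma integral_eq_antiderivative:
  fixes f :: "real \<Rightarrow> real"
  assumes "\<And>x. (F has_real_derivative f x) (at x)" and "a \<le> b"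
  shows "integral {a..b} f = F b - F a"
  using assms
  by (intro integral_unique fundamental_theorem_of_calculus)
    (auto intro: has_field_derivative_at_within
      simp flip: has_real_derivative_iff_has_vector_derivative)

text \<open>With a primitive \<open>F\<close>, the average is a multiple of
  \<open>F \<tau> - F (\<tau> - L)\<close>. This makes the integrand of \<open>est_yv\<close>, which
  contains a moving average, continuous.\<close>

lemma continuous_on_avg:
  assumes "L > 0" and "continuous_on UNIV f"
  shows "continuous_on UNIV (\<lambda>\<tau>. avg L \<tau> f)"
proof -
  obtain F where F: "\<And>x. (F has_real_derivative f x) (at x)"
    using antiderivative_UNIV assms(2) by blast
  have "avg L \<tau> f = 1 / L * (F \<tau> - F (\<tau> - L))" for \<tau>
    using \<open>L > 0\<close> by (simp add: avg_def integral_eq_antiderivative[OF F])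
  moreover have "continuous_on UNIV F"
    using F DERIV_isCont by (auto simp: continuous_on_eq_continuous_at)
  ultimately show ?thesis
    using \<open>L > 0\<close> by (auto intro!: continuous_intros elim: continuous_on_compose2)
qed

section \<open>Periodic functions\<close>

text \<open>A primitive of a periodic function grows by the same amount over every period, and the
  window holds exactly \<open>n\<close> periods of length \<open>\<epsilon>\<close>. It serves both
  for \<open>S\<close> and for its square.\<close>

lemma avg_periodic:
  fixes f :: "real \<Rightarrow> real"
  assumes cont: "continuous_on UNIV f" and per: "\<And>\<sigma>. f (\<sigma> + 1) = f \<sigma>"
    and n: "n \<ge> 1" and \<epsilon>: "\<epsilon> > 0"
  shows "avg (real n * \<epsilon>) t (\<lambda>\<tau>. f (\<tau> / \<epsilon>)) = integral {0..1} f"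
proof -
  obtain F where F: "\<And>x. (F has_real_derivative f x) (at x)"
    using antiderivative_UNIV cont by blast
  have I: "integral {0..1} f = F 1 - F 0"
    using integral_eq_antiderivative[OF F] by simp
  \<comment> \<open>By periodicity the increment over one period has derivative
    \<open>f (x + 1) - f x = 0\<close>, hence is constant.\<close>
  have "((\<lambda>x. F (x + 1) - F x) has_real_derivative 0) (at x)" for x
    using F[of x] F[of "x + 1"] per[of x]
    by (auto intro!: derivative_eq_intros DERIV_chain2[where f = F])
  then have step: "F (x + 1) - F x = F 1 - F 0" for x
    using DERIV_isconst_all[of "\<lambda>x. F (x + 1) - F x" x 0] by simp
  have shift: "F (x + real m) = F x + real m * (F 1 - F 0)" for x m
  proof (induction m)
    case (Suc m)
    then show ?case
      using step[of "x + real m"] by (simp add: algebra_simps)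
  qed simp
  have "((\<lambda>\<tau>. \<epsilon> * F (\<tau> / \<epsilon>)) has_real_derivative f (\<tau> / \<epsilon>)) (at \<tau>)" for \<tau>
    using F[of "\<tau> / \<epsilon>"] \<epsilon>
    by (auto intro!: derivative_eq_intros DERIV_chain2[where f = F])
  then have "integral {t - real n * \<epsilon>..t} (\<lambda>\<tau>. f (\<tau> / \<epsilon>))
      = \<epsilon> * F (t / \<epsilon>) - \<epsilon> * F ((t - real n * \<epsilon>) / \<epsilon>)"
    using \<epsilon> by (intro integral_eq_antiderivative[where F = "\<lambda>\<tau>. \<epsilon> * F (\<tau> / \<epsilon>)"]) auto
  moreover have "F (t / \<epsilon>) = F ((t - real n * \<epsilon>) / \<epsilon>) + real n * (F 1 - F 0)"
    using shift[of "(t - real n * \<epsilon>) / \<epsilon>" n] \<epsilon> by (simp add: diff_divide_distrib)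
  ultimately have "integral {t - real n * \<epsilon>..t} (\<lambda>\<tau>. f (\<tau> / \<epsilon>)) = (real n * \<epsilon>) * (F 1 - F 0)"
    by (simp add: algebra_simps)
  then show ?thesis
    using n \<epsilon> by (simp add: avg_def I)
qed

text \<open>Reduces questions on the whole line to the compact interval
  \<open>{0..1}\<close>.\<close>

lemma periodic_eq_frac:
  fixes f :: "real \<Rightarrow> real"
  assumes per: "\<And>\<sigma>. f (\<sigma> + 1) = f \<sigma>"
  shows "f \<sigma> = f (frac \<sigma>)"
proof -
  interpret periodic_fun_simple' f
    by unfold_locales (rule per)
  show ?thesis
    using plus_of_int[of "frac \<sigma>" "\<lfloor>\<sigma>\<rfloor>"] by (simp add: frac_def)
qed

lemma periodic_bounded:
  fixes f :: "real \<Rightarrow> real"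
  assumes "continuous_on UNIV f" and per: "\<And>\<sigma>. f (\<sigma> + 1) = f \<sigma>"
  obtains K where "K \<ge> 0" "\<And>\<sigma>. \<bar>f \<sigma>\<bar> \<le> K"
proof -
  have "compact (f ` {0..1})"
    using assms by (intro compact_continuous_image) (auto intro: continuous_on_subset)
  then obtain K where K: "\<And>\<sigma>. \<sigma> \<in> {0..1} \<Longrightarrow> \<bar>f \<sigma>\<bar> \<le> K"
    using compact_imp_bounded bounded_iff by (metis image_eqI real_norm_def)
  have "\<bar>f \<sigma>\<bar> \<le> K" for \<sigma>
    using K[of "frac \<sigma>"] periodic_eq_frac[of f \<sigma>] per
    by (auto simp: frac_ge_0 less_imp_le[OF frac_lt_1])
  moreover from this[of 0] have "K \<ge> 0"
    by linarith
  ultimately show thesis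
    using that by blast
qed

text \<open>A continuous nonnegative function with integral zero vanishes on all of
  \<open>{0..1}\<close>, but the fractional part of \<open>\<sigma>\<close> is a point there at
  which \<open>f\<close> is nonzero.\<close>

lemma periodic_integral_power2_pos:
  fixes f :: "real \<Rightarrow> real"
  assumes cont: "continuous_on UNIV f" and per: "\<And>\<sigma>. f (\<sigma> + 1) = f \<sigma>" and "f \<sigma> \<noteq> 0"
  shows "integral {0..1} (\<lambda>\<sigma>. (f \<sigma>)\<^sup>2) > 0"
proof -
  have c: "continuous_on {0..1} (\<lambda>\<sigma>. (f \<sigma>)\<^sup>2)"
    using cont by (auto intro!: continuous_intros intro: continuous_on_subset)
  have "frac \<sigma> \<in> {0..1}" "f (frac \<sigma>) \<noteq> 0"
    using periodic_eq_frac[of f \<sigma>] per \<open>f \<sigma> \<noteq> 0\<close>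
    by (auto simp: frac_ge_0 less_imp_le[OF frac_lt_1])
  then have "integral {0..1} (\<lambda>\<sigma>. (f \<sigma>)\<^sup>2) \<noteq> 0"
    using integral_eq_0_iff[OF c] by auto
  moreover have "integral {0..1} (\<lambda>\<sigma>. (f \<sigma>)\<^sup>2) \<ge> 0"
    by (intro integral_nonneg integrable_continuous_real c) auto
  ultimately show ?thesis
    by simp
qed

section \<open>Functions with bounded derivatives\<close>

text \<open>The mean value inequality. It is applied to functions of class \<open>C2\<close> and
  also to their first derivatives.\<close>

lemma DERIV_bounded_imp_Lipschitz:
  fixes f :: "real \<Rightarrow> real"
  assumes "f differentiable_on UNIV" and "bounded (range (deriv f))"
  obtains M where "M \<ge> 0" "\<And>x y. \<bar>f y - f x\<bar> \<le> M * \<bar>y - x\<bar>"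
proof -
  obtain M where M: "\<And>x. \<bar>deriv f x\<bar> \<le> M"
    using assms(2) by (auto simp: bounded_iff)
  have "(f has_real_derivative deriv f x) (at x)" for x
    using assms(1)
    by (simp add: differentiable_on_def real_differentiableE DERIV_deriv_iff_real_differentiable)
  then have "norm (f y - f x) \<le> M * norm (y - x)" for x y
    using M by (intro field_differentiable_bound[of UNIV f "deriv f"]) auto
  moreover have "M \<ge> 0"
    using M[of 0] by linarith
  ultimately show thesis
    using that by auto
qed

lemma C2_bounded_derivs_continuous: "C2_bounded_derivs f \<Longrightarrow> continuous_on UNIV f"
  by (simp add: C2_bounded_derivs_def C2_def differentiable_imp_continuous_on)

lemma C2_bounded_derivs_Lipschitz:
  assumes "C2_bounded_derivs f"
  obtains M where "M \<ge> 0" "\<And>x y. \<bar>f y - f x\<bar> \<le> M * \<bar>y - x\<bar>"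
  using assms DERIV_bounded_imp_Lipschitz[of f] unfolding C2_bounded_derivs_def C2_def by blast

text \<open>The second derivative enters only through a Lipschitz constant \<open>M\<close> of
  \<open>deriv f\<close>; the mean value inequality for \<open>f\<close> minus its tangent at
  \<open>x\<close> then gives the quadratic bound.\<close>

lemma C2_bounded_derivs_Taylor:
  assumes "C2_bounded_derivs f"
  obtains M where "M \<ge> 0" "\<And>x y. \<bar>f y - (f x + deriv f x * (y - x))\<bar> \<le> M * (y - x)\<^sup>2"
proof -
  obtain M where M: "M \<ge> 0" "\<And>x y. \<bar>deriv f y - deriv f x\<bar> \<le> M * \<bar>y - x\<bar>"
    using assms DERIV_bounded_imp_Lipschitz[of "deriv f"]
    unfolding C2_bounded_derivs_def C2_def by blast
  have D: "(f has_real_derivative deriv f x) (at x within A)" for x A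
    using assms
    by (auto simp: C2_bounded_derivs_def C2_def differentiable_on_def
        DERIV_deriv_iff_real_differentiable intro: has_field_derivative_at_within)
  have "\<bar>f y - (f x + deriv f x * (y - x))\<bar> \<le> M * (y - x)\<^sup>2" for x y
  proof -
    \<comment> \<open>The increment of \<open>?g\<close> from \<open>x\<close> to \<open>y\<close>
      is the tangent error, and its derivative at \<open>z\<close> is
      \<open>deriv f z - deriv f x\<close>, of size at most \<open>M * \<bar>y - x\<bar>\<close> on
      the segment.\<close>
    let ?g = "\<lambda>z. f z - deriv f x * z"
    have "norm (?g y - ?g x) \<le> (M * \<bar>y - x\<bar>) * norm (y - x)"
    proof (rule field_differentiable_bound[of "closed_segment x y"])
      show "(?g has_field_derivative deriv f z - deriv f x) (at z within closed_segment x y)" for z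
        by (auto intro!: derivative_eq_intros D)
      show "norm (deriv f z - deriv f x) \<le> M * \<bar>y - x\<bar>" if "z \<in> closed_segment x y" for z
      proof -
        have "\<bar>z - x\<bar> \<le> \<bar>y - x\<bar>"
          using that by (auto simp: closed_segment_eq_real_ivl split: if_splits)
        then have "M * \<bar>z - x\<bar> \<le> M * \<bar>y - x\<bar>"
          using M(1) by (rule mult_left_mono)
        then show ?thesis
          using M(2)[of z x] by simp
      qed
    qed auto
    then show ?thesis
      by (simp add: algebra_simps power2_eq_square)
  qed
  with M(1) show thesis
    using that by blast
qed

section \<open>Error of the estimators\<close>

lemma abs_mult_le:
  fixes a b A B :: real
  assumes "\<bar>a\<bar> \<le> A" "\<bar>b\<bar> \<le> B"
  shows "\<bar>a * b\<bar> \<le> A * B"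
  unfolding abs_mult using assms by (intro mult_mono) auto

lemma avg_signal_diff_le:
  assumes S: "continuous_on UNIV S" "\<And>\<sigma>. S (\<sigma> + 1) = S \<sigma>" "integral {0..1} S = 0"
    and K: "\<And>\<sigma>. \<bar>S \<sigma>\<bar> \<le> K"
    and yb: "continuous_on UNIV yb" and yv: "continuous_on UNIV yv"
    and M: "M \<ge> 0" "\<And>x y. \<bar>yv y - yv x\<bar> \<le> M * \<bar>y - x\<bar>"
    and n: "n \<ge> 1" and \<epsilon>: "\<epsilon> > 0"
    and g: "continuous_on UNIV g"
    and B: "\<And>\<tau>. \<tau> \<in> {t - real n * \<epsilon>..t} \<Longrightarrow> \<bar>yb \<tau> - g \<tau>\<bar> \<le> B"
  shows "\<bar>avg (real n * \<epsilon>) t (signal yb yv S \<epsilon>) - avg (real n * \<epsilon>) t g\<bar>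
           \<le> B + \<epsilon> * (M * (real n * \<epsilon>) * K)"
proof -
  let ?L = "real n * \<epsilon>"
  have L: "?L > 0"
    using n \<epsilon> by simp
  have contS: "continuous_on UNIV (\<lambda>\<tau>. S (\<tau> / \<epsilon>))"
    using \<epsilon> by (intro continuous_on_compose2[OF S(1)] continuous_intros) auto
  let ?h = "\<lambda>\<tau>. g \<tau> + \<epsilon> * yv t * S (\<tau> / \<epsilon>)"
  have "\<bar>avg ?L t (signal yb yv S \<epsilon>) - avg ?L t ?h\<bar> \<le> B + \<epsilon> * (M * ?L * K)"
  proof (rule avg_diff_le[OF L])
    show "continuous_on UNIV (signal yb yv S \<epsilon>)"
      unfolding signal_def by (intro continuous_intros yb yv contS)
    show "continuous_on UNIV ?h"
      by (intro continuous_intros g contS)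
    fix \<tau> assume \<tau>: "\<tau> \<in> {t - ?L..t}"
    have "\<bar>yv \<tau> - yv t\<bar> \<le> M * ?L"
      using M(2)[of \<tau> t] mult_left_mono[OF _ M(1), of "\<bar>\<tau> - t\<bar>" ?L] \<tau> by auto
    then have "\<epsilon> * \<bar>(yv \<tau> - yv t) * S (\<tau> / \<epsilon>)\<bar> \<le> \<epsilon> * (M * ?L * K)"
      using K \<epsilon> by (intro mult_left_mono abs_mult_le) auto
    moreover have "signal yb yv S \<epsilon> \<tau> - ?h \<tau> = (yb \<tau> - g \<tau>) + \<epsilon> * ((yv \<tau> - yv t) * S (\<tau> / \<epsilon>))"
      by (simp add: signal_def algebra_simps)
    moreover have "\<bar>\<epsilon> * ((yv \<tau> - yv t) * S (\<tau> / \<epsilon>))\<bar> = \<epsilon> * \<bar>(yv \<tau> - yv t) * S (\<tau> / \<epsilon>)\<bar>"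
      using \<epsilon> by (simp add: abs_mult)
    ultimately show "\<bar>signal yb yv S \<epsilon> \<tau> - ?h \<tau>\<bar> \<le> B + \<epsilon> * (M * ?L * K)"
      using B[OF \<tau>] by linarith
  qed
  moreover have "avg ?L t ?h = avg ?L t g"
    using avg_periodic[OF S(1,2) n \<epsilon>] S(3)
    by (simp add: avg_add avg_cmult g contS continuous_on_mult_left)
  ultimately show ?thesis
    by simp
qed

theorem proposition1:
  fixes S yb yv :: "real \<Rightarrow> real"
  assumes "continuous_on UNIV S"
    and "\<And>\<sigma>. S (\<sigma> + 1) = S \<sigma>"
    and "integral {0..1} S = 0"
    and "\<exists>\<sigma>. S \<sigma> \<noteq> 0"
    and "C2_bounded_derivs yb"
    and "C2_bounded_derivs yv"
  shows "O_infty (\<lambda>t n \<epsilon>. est_yb (signal yb yv S \<epsilon>) n \<epsilon> t - yb (t - real n * \<epsilon> / 2))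
           (\<lambda>n \<epsilon>. (real n)\<^sup>2 * \<epsilon>\<^sup>2)
    \<and> O_infty (\<lambda>t n \<epsilon>. est_yb (signal yb yv S \<epsilon>) n \<epsilon> t - yb t)
           (\<lambda>n \<epsilon>. real n * \<epsilon>)
    \<and> O_infty (\<lambda>t n \<epsilon>. est_yv S (signal yb yv S \<epsilon>) n \<epsilon> t - yv t)
           (\<lambda>n \<epsilon>. (real n)\<^sup>2 * \<epsilon>)"
proof -
  note S = assms(1-3)
  have cb: "continuous_on UNIV yb" and cv: "continuous_on UNIV yv"
    using assms(5,6) by (simp_all add: C2_bounded_derivs_continuous)
  obtain K where K: "K \<ge> 0" "\<And>\<sigma>. \<bar>S \<sigma>\<bar> \<le> K"
    using periodic_bounded assms(1,2) by blast
  obtain M where M: "M \<ge> 0" "\<And>x y. \<bar>yv y - yv x\<bar> \<le> M * \<bar>y - x\<bar>"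
    using C2_bounded_derivs_Lipschitz assms(6) by blast
  obtain M1 where M1: "M1 \<ge> 0" "\<And>x y. \<bar>yb y - yb x\<bar> \<le> M1 * \<bar>y - x\<bar>"
    using C2_bounded_derivs_Lipschitz assms(5) by blast
  obtain M2 where M2: "M2 \<ge> 0"
      "\<And>x y. \<bar>yb y - (yb x + deriv yb x * (y - x))\<bar> \<le> M2 * (y - x)\<^sup>2"
    using C2_bounded_derivs_Taylor assms(5) by blast
  \<comment> \<open>The value of the denominator of \<open>est_yv\<close>.\<close>
  define D where "D = integral {0..1} (\<lambda>\<sigma>. (S \<sigma>)\<^sup>2)"
  have D: "D > 0"
    using assms(4) periodic_integral_power2_pos[OF assms(1,2)] by (auto simp: D_def)
  note signal_le = avg_signal_diff_le[OF S K(2) cb cv M]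
  \<comment> \<open>\<open>M2\<close> comes from the tangent of \<open>yb\<close>,
    \<open>M * K\<close> from freezing \<open>yv\<close>.\<close>
  let ?C = "M2 + M * K"

  have mid: "\<bar>avg (real n * \<epsilon>) t (signal yb yv S \<epsilon>) - yb (t - real n * \<epsilon> / 2)\<bar>
      \<le> ?C * (real n * \<epsilon>)\<^sup>2" if n: "n \<ge> 1" and \<epsilon>: "\<epsilon> > 0" for t n \<epsilon>
  proof -
    let ?L = "real n * \<epsilon>" and ?m = "t - real n * \<epsilon> / 2"
    let ?g = "\<lambda>\<tau>. yb ?m + deriv yb ?m * (\<tau> - ?m)"
    have L: "?L > 0"
      using n \<epsilon> by simp
    have "\<bar>avg ?L t (signal yb yv S \<epsilon>) - avg ?L t ?g\<bar> \<le> M2 * ?L\<^sup>2 + \<epsilon> * (M * ?L * K)"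
    proof (rule signal_le[OF n \<epsilon>])
      show "continuous_on UNIV ?g"
        by (intro continuous_intros)
      fix \<tau> assume "\<tau> \<in> {t - ?L..t}"
      then have "(\<tau> - ?m)\<^sup>2 \<le> ?L\<^sup>2"
        by (intro power2_le_iff_abs_le[THEN iffD2]) (auto simp: abs_le_iff)
      then have "M2 * (\<tau> - ?m)\<^sup>2 \<le> M2 * ?L\<^sup>2"
        using M2(1) by (rule mult_left_mono)
      then show "\<bar>yb \<tau> - ?g \<tau>\<bar> \<le> M2 * ?L\<^sup>2"
        using M2(2)[of \<tau> ?m] by linarith
    qed
    \<comment> \<open>Since \<open>n \<ge> 1\<close>, \<open>\<epsilon>\<close> is at most
      \<open>?L\<close>, so the oscillation error is also quadratic in \<open>?L\<close>.\<close>
    moreover have "\<epsilon> * (M * ?L * K) \<le> ?L * (M * ?L * K)"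
      using n \<epsilon> M(1) K(1) L by (intro mult_right_mono mult_nonneg_nonneg) auto
    moreover have "avg ?L t ?g = yb ?m"
      using avg_affine[OF L] by simp
    ultimately show ?thesis
      by (simp add: power2_eq_square algebra_simps)
  qed

  have "\<bar>avg (real n * \<epsilon>) t (signal yb yv S \<epsilon>) - yb t\<bar> \<le> (M1 + M * K) * (real n * \<epsilon>)"
    if n: "n \<ge> 1" and \<epsilon>: "\<epsilon> \<in> {0<..1}" for t n \<epsilon>
  proof -
    let ?L = "real n * \<epsilon>"
    have L: "?L > 0"
      using n \<epsilon> by simp
    have "\<bar>avg ?L t (signal yb yv S \<epsilon>) - avg ?L t (\<lambda>\<tau>. yb t)\<bar> \<le> M1 * ?L + \<epsilon> * (M * ?L * K)"
    proof (rule signal_le[OF n])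
      fix \<tau> assume "\<tau> \<in> {t - ?L..t}"
      then show "\<bar>yb \<tau> - yb t\<bar> \<le> M1 * ?L"
        using M1(2)[of \<tau> t] mult_left_mono[OF _ M1(1), of "\<bar>\<tau> - t\<bar>" ?L] by auto
    qed (use \<epsilon> in auto)
    \<comment> \<open>Here \<open>\<epsilon> \<le> 1\<close> makes the oscillation error linear in
      \<open>?L\<close>.\<close>
    moreover have "\<epsilon> * (M * ?L * K) \<le> 1 * (M * ?L * K)"
      using \<epsilon> M(1) K(1) L by (intro mult_right_mono mult_nonneg_nonneg) auto
    moreover have "avg ?L t (\<lambda>\<tau>. yb t) = yb t"
      using avg_affine[OF L, of t "yb t" 0] by simp
    ultimately show ?thesis
      by (simp add: algebra_simps)
  qed
  moreover have "\<bar>est_yv S (signal yb yv S \<epsilon>) n \<epsilon> t - yv t\<bar>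
      \<le> (?C + 2 * M * K) * K / D * ((real n)\<^sup>2 * \<epsilon>)"
    if n: "n \<ge> 1" and \<epsilon>: "\<epsilon> > 0" for t n \<epsilon>
  proof -
    let ?L = "real n * \<epsilon>" and ?y = "signal yb yv S \<epsilon>"
    let ?s = "\<lambda>\<tau>. S ((\<tau> - ?L / 2) / \<epsilon>)"
    let ?f = "\<lambda>\<tau>. (?y (\<tau> - ?L / 2) - avg ?L \<tau> ?y) * ?s \<tau>"
    \<comment> \<open>\<open>?C\<close> bounds the error of the inner estimate of \<open>yb\<close>,
      \<open>2 * M * K\<close> that of freezing \<open>yv\<close>; the last factor \<open>K\<close>
      bounds \<open>?s\<close>.\<close>
    let ?B = "(?C + 2 * M * K) * K * ((real n)\<^sup>2 * \<epsilon>\<^sup>2)"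
    have L: "?L > 0"
      using n \<epsilon> by simp
    have contS: "continuous_on UNIV (\<lambda>\<tau>. S (\<tau> / \<epsilon>))"
      using \<epsilon> by (intro continuous_on_compose2[OF S(1)] continuous_intros) auto
    have conty: "continuous_on UNIV ?y"
      unfolding signal_def by (intro continuous_intros cb cv contS)
    have conts: "continuous_on UNIV ?s"
      by (intro continuous_on_compose2[OF contS] continuous_intros) auto
    have contyshift: "continuous_on UNIV (\<lambda>\<tau>. ?y (\<tau> - ?L / 2))"
      by (intro continuous_on_compose2[OF conty] continuous_intros) auto
    have "\<bar>avg ?L t ?f - avg ?L t (\<lambda>\<tau>. \<epsilon> * yv t * (?s \<tau>)\<^sup>2)\<bar> \<le> ?B"
    proof (rule avg_diff_le[OF L])
      show "continuous_on UNIV ?f"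
        by (intro continuous_intros contyshift continuous_on_avg L conty conts)
      show "continuous_on UNIV (\<lambda>\<tau>. \<epsilon> * yv t * (?s \<tau>)\<^sup>2)"
        by (intro continuous_intros conts)
      fix \<tau> assume \<tau>: "\<tau> \<in> {t - ?L..t}"
      \<comment> \<open>The integrand minus its model
        \<open>\<epsilon> * yv t * (?s \<tau>)\<^sup>2\<close> is
        \<open>(?a + \<epsilon> * ?b) * ?s \<tau>\<close>. The delay by \<open>?L / 2\<close> lets
        \<open>mid\<close> at \<open>\<tau>\<close> bound \<open>?a\<close> to second order.\<close>
      let ?a = "yb (\<tau> - ?L / 2) - avg ?L \<tau> ?y"
      let ?b = "(yv (\<tau> - ?L / 2) - yv t) * ?s \<tau>"
      \<comment> \<open>The two arguments are at most \<open>3 / 2 * ?L\<close> apart, rounded up to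
        \<open>2 * ?L\<close>.\<close>
      have "\<bar>yv (\<tau> - ?L / 2) - yv t\<bar> \<le> M * (2 * ?L)"
        using M(2)[of "\<tau> - ?L / 2" t] \<tau> L
          mult_left_mono[OF _ M(1), of "\<bar>\<tau> - ?L / 2 - t\<bar>" "2 * ?L"] by auto
      then have "\<bar>?b\<bar> \<le> M * (2 * ?L) * K"
        using K(2) by (rule abs_mult_le)
      then have "\<epsilon> * \<bar>?b\<bar> \<le> ?L * (M * (2 * ?L) * K)"
        using n \<epsilon> L M(1) K(1) by (intro mult_mono) auto
      moreover have "\<bar>\<epsilon> * ?b\<bar> = \<epsilon> * \<bar>?b\<bar>"
        using \<epsilon> by (simp add: abs_mult)
      moreover have "\<bar>?a\<bar> \<le> ?C * ?L\<^sup>2"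
        using mid[OF n \<epsilon>, of \<tau>] by (simp add: abs_minus_commute)
      ultimately have "\<bar>?a + \<epsilon> * ?b\<bar> \<le> ?C * ?L\<^sup>2 + ?L * (M * (2 * ?L) * K)"
        by linarith
      then have "\<bar>(?a + \<epsilon> * ?b) * ?s \<tau>\<bar> \<le> (?C * ?L\<^sup>2 + ?L * (M * (2 * ?L) * K)) * K"
        using K(2) by (rule abs_mult_le)
      moreover have "?f \<tau> - \<epsilon> * yv t * (?s \<tau>)\<^sup>2 = (?a + \<epsilon> * ?b) * ?s \<tau>"
        by (simp add: signal_def algebra_simps power2_eq_square)
      moreover have "(?C * ?L\<^sup>2 + ?L * (M * (2 * ?L) * K)) * K = ?B"
        by (simp add: algebra_simps power2_eq_square)
      ultimately show "\<bar>?f \<tau> - \<epsilon> * yv t * (?s \<tau>)\<^sup>2\<bar> \<le> ?B"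
        by simp
    qed
    \<comment> \<open>The end point \<open>u\<close> is arbitrary: the denominator needs
      \<open>t\<close>, the shifted average below needs \<open>t - ?L / 2\<close>.\<close>
    moreover have avgD: "avg ?L u (\<lambda>\<tau>. (S (\<tau> / \<epsilon>))\<^sup>2) = D" for u
      unfolding D_def using assms(1,2) n \<epsilon>
      by (intro avg_periodic[where f = "\<lambda>\<sigma>. (S \<sigma>)\<^sup>2"] continuous_intros) auto
    \<comment> \<open>For odd \<open>n\<close> the delay \<open>?L / 2\<close> is not a whole number
      of periods, so the window itself is translated.\<close>
    moreover have "avg ?L t (\<lambda>\<tau>. (?s \<tau>)\<^sup>2) = D"
    proof -
      have "avg ?L t (\<lambda>\<tau>. (?s \<tau>)\<^sup>2) = avg ?L (t - ?L / 2) (\<lambda>\<tau>. (S (\<tau> / \<epsilon>))\<^sup>2)"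
        unfolding avg_def
        using integral_shift_real_ivl[of "t - ?L / 2 - ?L" "- ?L / 2" "t - ?L / 2" "\<lambda>\<tau>. (S (\<tau> / \<epsilon>))\<^sup>2"]
        by (simp add: algebra_simps)
      then show ?thesis
        by (simp add: avgD)
    qed
    ultimately have "\<bar>avg ?L t ?f - \<epsilon> * yv t * D\<bar> \<le> ?B"
      by (simp only: avg_cmult)
    \<comment> \<open>Division by \<open>\<epsilon>\<close> from the prefactor and by
      \<open>D\<close> from the denominator lowers the order of the error from
      \<open>\<epsilon>\<^sup>2\<close> to \<open>\<epsilon>\<close>.\<close>
    moreover have "est_yv S ?y n \<epsilon> t - yv t = (avg ?L t ?f - \<epsilon> * yv t * D) / (\<epsilon> * D)"
      unfolding est_yv_eq_avg avgD using \<epsilon> D by (simp add: diff_divide_distrib)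
    ultimately have "\<bar>est_yv S ?y n \<epsilon> t - yv t\<bar> \<le> ?B / (\<epsilon> * D)"
      using \<epsilon> D by (simp add: abs_divide abs_mult divide_right_mono)
    also have "?B / (\<epsilon> * D) = (?C + 2 * M * K) * K / D * ((real n)\<^sup>2 * \<epsilon>)"
      using \<epsilon> D by (simp add: field_simps power2_eq_square)
    finally show ?thesis .
  qed
  ultimately show ?thesis
    using mid unfolding O_infty_def est_yb_eq_avg power_mult_distrib
    by (meson greaterThanAtMost_iff)
qed

end
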